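(* Let $P$ be a complex polynomial of degree $n\geq 3$ with an attracting fixed point at $0$. Then $P$ satisfies $\ddagger$ if and only if $P(z)=\sum_{k=1}^{n}a_kz^k$ where $a_{n-1}=0$ and $a_{n-2}=\dfrac{-na_n}{2}$.
   Context: A complex polynomial $P$ has an attracting fixed point at $0$ if $P(0)=0$ and $|P'(0)|<1$. Its basin of attraction at $0$ is $B_{P,0}=\{z\in\mathbb{C}:\lim_{m\to\infty}P^{\circ m}(z)=0\}$, where $P^{\circ m}$ is the $m$-th iterate of $P$. For $z\in\mathbb{C}$, $M(z)$ denotes the number of solutions $\zeta\in\mathbb{C}$ of $P(\zeta)=z$, counted with multiplicity, and every sum $\sum_{P(\zeta)=z}$ runs over these solutions repeated according to multiplicity. The polynomial $P$ satisfies $\ddagger$ if for every $z\in B_{P,0}$ one has $M(z)<\infty$ and $$\sum_{P(\zeta)=z}1=M(z),\qquad \sum_{P(\zeta)=z}\zeta=0,\qquad \sum_{P(\zeta)=z}\zeta^2=M(z).$$ *)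

theory Defs
  imports
    "HOL-Analysis.Analysis"
    "HOL-Computational_Algebra.Computational_Algebra"
    "HOL-Library.Extended_Nat"
begin

definition attracting_fixed_point_at_0 :: "complex poly \<Rightarrow> bool" where
  "attracting_fixed_point_at_0 P \<longleftrightarrow> poly P 0 = 0 \<and> norm (poly (pderiv P) 0) < 1"

definition basin_at_0 :: "complex poly \<Rightarrow> complex set" where
  "basin_at_0 P = {z. (\<lambda>m. (poly P ^^ m) z) \<longlonglongrightarrow> 0}"

(* The solutions of poly P \<zeta> = z, repeated according to multiplicity, are the roots of P - z.
   If P is the constant z, this multiset is empty although every \<zeta> is a solution; solution_count
   is \<infinity> in that case. *)
definition solutions :: "complex poly \<Rightarrow> complex \<Rightarrow> complex multiset" where
  "solutions P z = proots (P - [:z:])"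

definition solution_count :: "complex poly \<Rightarrow> complex \<Rightarrow> enat" where
  "solution_count P z =
     (if finite {\<zeta>. poly P \<zeta> = z} then enat (size (solutions P z)) else \<infinity>)"

(* M is the value of solution_count P z, which is thereby required to be finite. *)
definition double_dagger :: "complex poly \<Rightarrow> bool" where
  "double_dagger P \<longleftrightarrow>
     (\<forall>z\<in>basin_at_0 P. \<exists>M::nat. solution_count P z = enat M \<and>
        (\<Sum>\<zeta>\<in>#solutions P z. (1::complex)) = of_nat M \<and>
        (\<Sum>\<zeta>\<in>#solutions P z. \<zeta>) = 0 \<and>
        (\<Sum>\<zeta>\<in>#solutions P z. \<zeta>^2) = of_nat M)"

end

theory Submission
  imports Defs
begin

text \<open>
  The first two power sums of the roots of a polynomial of degree \<open>n\<close> depend only on its three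
  leading coefficients, by Newton's identities. For \<open>n \<ge> 3\<close> the constant term is not among these,
  and it is the only coefficient in which \<open>P - z\<close> differs from \<open>P\<close>. Hence the sums of \<open>\<zeta>\<close> and of
  \<open>\<zeta>\<^sup>2\<close> over \<open>P(\<zeta>) = z\<close> are the same for all \<open>z\<close> (lemma \<open>power_sums_solutions\<close>). So is \<open>M(z) = n\<close>,
  by the fundamental theorem of algebra. The equations of \<open>\<ddagger>\<close> therefore hold on the whole plane
  as soon as they hold at one point, and the basin is not empty: it contains the fixed point \<open>0\<close>.
  The two nontrivial equations read \<open>- a\<^sub>n\<^sub>-\<^sub>1 / a\<^sub>n = 0\<close> and
  \<open>(a\<^sub>n\<^sub>-\<^sub>1 / a\<^sub>n)\<^sup>2 - 2 a\<^sub>n\<^sub>-\<^sub>2 / a\<^sub>n = n\<close>, which are the two conditions on the coefficients.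
\<close>

lemma reflect_poly_prod_linear_factors:
  fixes A :: "'a::idom multiset"
  shows "reflect_poly (\<Prod>x\<in>#A. [:- x, 1:]) = (\<Prod>x\<in>#A. [:1, - x:])"
proof -
  have "reflect_poly [:- x, 1:] = [:1, - x:]" for x :: 'a
    by (simp add: reflect_poly_def)
  then show ?thesis
    by (induction A) (simp_all add: reflect_poly_mult del: mult_pCons_left)
qed

text \<open>
  The factors \<open>1 - x X\<close> have constant term \<open>1\<close>, so the elementary symmetric functions of \<open>A\<close> sit in
  positions that do not depend on the size of \<open>A\<close>, and induction on \<open>A\<close> goes through
  directly. The doubled second one is stated through power sums.
\<close>

lemma low_coeffs_prod_reflected_factors:
  fixes A :: "'a::comm_ring_1 multiset"
  defines "Q \<equiv> \<Prod>x\<in>#A. [:1, - x:]"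
  shows "coeff Q 0 = 1"
    and "coeff Q 1 = - (\<Sum>x\<in>#A. x)"
    and "2 * coeff Q 2 = (\<Sum>x\<in>#A. x)\<^sup>2 - (\<Sum>x\<in>#A. x\<^sup>2)"
proof -
  have "coeff Q 0 = 1 \<and> coeff Q 1 = - (\<Sum>x\<in>#A. x) \<and>
      2 * coeff Q 2 = (\<Sum>x\<in>#A. x)\<^sup>2 - (\<Sum>x\<in>#A. x\<^sup>2)"
    unfolding Q_def
  proof (induction A)
    case empty
    then show ?case by simp
  next
    case (add y A)
    define R where "R = (\<Prod>x\<in>#A. [:1, - x:])"
    have prod_add: "(\<Prod>x\<in>#add_mset y A. [:1, - x:]) = R + pCons 0 (smult (- y) R)"
      by (simp add: R_def)
    show ?case
      using add.IH unfolding prod_add R_def[symmetric]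
      by (auto simp: numeral_2_eq_2 power2_eq_square algebra_simps)
  qed
  then show "coeff Q 0 = 1" "coeff Q 1 = - (\<Sum>x\<in>#A. x)"
    "2 * coeff Q 2 = (\<Sum>x\<in>#A. x)\<^sup>2 - (\<Sum>x\<in>#A. x\<^sup>2)"
    by auto
qed

lemma power_sums_proots:
  fixes p :: "complex poly"
  assumes "degree p \<ge> 2"
  shows "lead_coeff p * (\<Sum>x\<in>#proots p. x) = - coeff p (degree p - 1)"
    and "lead_coeff p * ((\<Sum>x\<in>#proots p. x)\<^sup>2 - (\<Sum>x\<in>#proots p. x\<^sup>2))
      = 2 * coeff p (degree p - 2)"
proof -
  define Q where "Q = (\<Prod>x\<in>#proots p. [:1, - x:])"
  have "reflect_poly p = smult (lead_coeff p) Q"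
    by (subst complex_poly_decompose_multiset[symmetric])
      (simp add: reflect_poly_smult reflect_poly_prod_linear_factors Q_def)
  then have coeff_Q: "coeff p (degree p - k) = lead_coeff p * coeff Q k" if "k \<le> degree p" for k
    using that by (metis coeff_reflect_poly coeff_smult not_less)
  show "lead_coeff p * (\<Sum>x\<in>#proots p. x) = - coeff p (degree p - 1)"
    using coeff_Q[of 1] assms low_coeffs_prod_reflected_factors(2)[of "proots p"]
    by (simp add: Q_def)
  show "lead_coeff p * ((\<Sum>x\<in>#proots p. x)\<^sup>2 - (\<Sum>x\<in>#proots p. x\<^sup>2))
      = 2 * coeff p (degree p - 2)"
    using coeff_Q[of 2] assms low_coeffs_prod_reflected_factors(3)[of "proots p"]
    by (simp add: Q_def mult.left_commute)
qed

lemma degree_minus_const: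
  fixes p :: "'a::ab_group_add poly"
  shows "degree (p - [:c:]) = degree p"
proof (cases "degree p = 0")
  case True
  then show ?thesis
    by (metis degree_pCons_0 diff_pCons degree_0_id diff_self degree_eq_zeroE)
next
  case False
  then have "degree (p + - [:c:]) = degree p"
    by (intro degree_add_eq_left) simp
  then show ?thesis
    by (simp only: diff_conv_add_uminus)
qed

lemma coeff_minus_const:
  fixes p :: "'a::ab_group_add poly"
  shows "k > 0 \<Longrightarrow> coeff (p - [:c:]) k = coeff p k"
  by (simp add: coeff_pCons split: nat.split)

text \<open>Degree at least \<open>3\<close> keeps the constant term, and with it \<open>z\<close>, out of the right-hand sides.\<close>

lemma power_sums_solutions:
  fixes P :: "complex poly"
  assumes "degree P \<ge> 3"
  shows "lead_coeff P * (\<Sum>\<zeta>\<in>#solutions P z. \<zeta>) = - coeff P (degree P - 1)"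
    and "lead_coeff P * ((\<Sum>\<zeta>\<in>#solutions P z. \<zeta>)\<^sup>2 - (\<Sum>\<zeta>\<in>#solutions P z. \<zeta>\<^sup>2))
      = 2 * coeff P (degree P - 2)"
  using power_sums_proots[of "P - [:z:]"] assms
  by (simp_all add: solutions_def degree_minus_const coeff_minus_const del: coeff_diff)

lemma solution_count_eq_degree:
  fixes P :: "complex poly"
  assumes "degree P > 0"
  shows "solution_count P z = enat (degree P)" and "size (solutions P z) = degree P"
proof -
  have "P - [:z:] \<noteq> 0"
    using assms degree_minus_const[of P z] by auto
  then have "finite {\<zeta>. poly (P - [:z:]) \<zeta> = 0}"
    by (rule poly_roots_finite)
  then have "finite {\<zeta>. poly P \<zeta> = z}"
    by simp
  moreover show size: "size (solutions P z) = degree P"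
    by (simp add: solutions_def size_proots_complex degree_minus_const)
  ultimately show "solution_count P z = enat (degree P)"
    by (simp add: solution_count_def)
qed

lemma zero_in_basin:
  assumes "poly P 0 = 0"
  shows "0 \<in> basin_at_0 P"
proof -
  have "(poly P ^^ m) 0 = 0" for m
    by (induction m) (use assms in auto)
  then show ?thesis
    by (simp add: basin_at_0_def)
qed

lemma double_dagger_iff_coeffs:
  fixes P :: "complex poly"
  assumes deg: "degree P \<ge> 3" and fixed: "poly P 0 = 0"
  shows "double_dagger P \<longleftrightarrow> coeff P (degree P - 1) = 0 \<and>
    coeff P (degree P - 2) = - (of_nat (degree P) * lead_coeff P) / 2"
    (is "_ \<longleftrightarrow> ?C")
proof -
  have lc: "lead_coeff P \<noteq> 0"
    using deg by auto
  have sums_iff: "(\<Sum>\<zeta>\<in>#solutions P z. \<zeta>) = 0 \<and> (\<Sum>\<zeta>\<in>#solutions P z. \<zeta>\<^sup>2) = of_nat (degree P)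
      \<longleftrightarrow> ?C" (is "?s1 = 0 \<and> ?s2 = _ \<longleftrightarrow> _") for z
  proof -
    note power_sums = power_sums_solutions[OF deg, of z]
    have "?s1 = 0 \<longleftrightarrow> coeff P (degree P - 1) = 0"
      using power_sums(1) lc by (metis mult_eq_0_iff neg_equal_0_iff_equal)
    moreover have "?s2 = of_nat (degree P) \<longleftrightarrow>
        coeff P (degree P - 2) = - (of_nat (degree P) * lead_coeff P) / 2" if "?s1 = 0"
    proof -
      have "coeff P (degree P - 2) = - (?s2 * lead_coeff P) / 2"
        using power_sums(2) that by (simp add: field_simps add_eq_0_iff2)
      then show ?thesis
        using lc by simp
    qed
    ultimately show ?thesis
      by blast
  qed
  have "double_dagger P \<longleftrightarrow> (\<forall>z\<in>basin_at_0 P. (\<Sum>\<zeta>\<in>#solutions P z. \<zeta>) = 0 \<and>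
      (\<Sum>\<zeta>\<in>#solutions P z. \<zeta>\<^sup>2) = of_nat (degree P))"
    using deg by (auto simp: double_dagger_def solution_count_eq_degree)
  also have "\<dots> \<longleftrightarrow> (\<forall>z\<in>basin_at_0 P. ?C)"
    unfolding sums_iff ..
  also have "\<dots> \<longleftrightarrow> ?C"
    using zero_in_basin[OF fixed] by blast
  finally show ?thesis .
qed

lemma poly_eq_sum_from_1_iff:
  fixes p :: "'a::{comm_ring_1,ring_no_zero_divisors,ring_char_0} poly"
  assumes "poly p 0 = 0" and "degree p \<le> n"
  shows "(\<forall>z. poly p z = (\<Sum>k=1..n. a k * z ^ k)) \<longleftrightarrow> (\<forall>k\<in>{1..n}. a k = coeff p k)"
proof -
  define q where "q = (\<Sum>k=1..n. monom (a k) k)"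
  have coeff_q: "coeff q k = (if k \<in> {1..n} then a k else 0)" for k
    by (simp add: q_def coeff_sum)
  have "(\<forall>z. poly p z = (\<Sum>k=1..n. a k * z ^ k)) \<longleftrightarrow> poly p = poly q"
    by (auto simp: q_def poly_sum poly_monom fun_eq_iff)
  also have "\<dots> \<longleftrightarrow> (\<forall>k. coeff p k = coeff q k)"
    by (simp add: poly_eq_poly_eq_iff poly_eq_iff)
  also have "\<dots> \<longleftrightarrow> (\<forall>k\<in>{1..n}. a k = coeff p k)"
  proof -
    have "coeff p k = 0" if "k \<notin> {1..n}" for k
      using that assms by (cases "k = 0") (auto simp: poly_0_coeff_0 coeff_eq_0)
    then show ?thesis
      unfolding coeff_q by metis
  qed
  finally show ?thesis .
qed

theorem theorem4:
  fixes P :: "complex poly" and n :: nat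
  assumes "degree P = n" and "n \<ge> 3" and "attracting_fixed_point_at_0 P"
  shows "double_dagger P \<longleftrightarrow>
    (\<exists>a :: nat \<Rightarrow> complex. (\<forall>z. poly P z = (\<Sum>k=1..n. a k * z^k)) \<and>
       a (n - 1) = 0 \<and> a (n - 2) = - (of_nat n * a n) / 2)"
proof -
  have fixed: "poly P 0 = 0"
    using assms(3) by (simp add: attracting_fixed_point_at_0_def)
  have indices: "n - 1 \<in> {1..n}" "n - 2 \<in> {1..n}" "n \<in> {1..n}"
    using assms(2) by auto
  have "double_dagger P \<longleftrightarrow>
      coeff P (n - 1) = 0 \<and> coeff P (n - 2) = - (of_nat n * coeff P n) / 2"
    using double_dagger_iff_coeffs[of P] fixed assms by simp
  also have "\<dots> \<longleftrightarrow> (\<exists>a. (\<forall>k\<in>{1..n}. a k = coeff P k) \<and>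
      a (n - 1) = 0 \<and> a (n - 2) = - (of_nat n * a n) / 2)"
    using indices by (metis (no_types, lifting))
  also have "\<dots> \<longleftrightarrow> (\<exists>a. (\<forall>z. poly P z = (\<Sum>k=1..n. a k * z^k)) \<and>
      a (n - 1) = 0 \<and> a (n - 2) = - (of_nat n * a n) / 2)"
    using poly_eq_sum_from_1_iff[OF fixed, of n] assms(1) by simp
  finally show ?thesis .
qed

end
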